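(* Let $n,m,k$ be natural numbers with $m+k\le n$. The $(n,m,k)$ gods puzzle (with $n$ gods, of which $m$ are random, $k$ are truthful and $n-m-k$ are lying) is solvable if and only if the number of random gods is strictly less than the number of non-random gods, i.e. if and only if $m<n-m$.
   Context: The $(n,m,k)$ gods puzzle: there are $n$ distinguishable gods $\gamma_1,\dots,\gamma_n$, each of exactly one type: truthful ($\mathcal{T}$), lying ($\mathcal{F}$) or random ($\mathcal{R}$). Exactly $m$ gods are random, exactly $k$ are truthful and exactly $n-m-k$ are lying. The numbers $n,m,k$ are known to the solver, but which god has which type is not. The solver asks yes/no questions, each directed at one god of the solver's choice, and questions may be chosen adaptively. There is no restriction on the number of questions. The gods understand the questions but answer with one of two words, one of which is `$\chi$'. One of the two words means yes and the other means no, and the solver does not know which. A question is any yes/no question having a definite truth value given the actual state (the types of the gods and the meaning of $\chi$), including hypothetical questions to a non-random god about how that god would answer some other question. A truthful god gives the word for the true answer, a lying god gives the word for the opposite of the true answer, and a random god answers randomly, so that either word may be given at any time. The puzzle is solvable if there is a (finite, adaptive) strategy of questions after which the type of every god is determined with certainty, whatever the actual assignment of types, whatever the meaning of $\chi$, and whatever answers the random gods happen to give. The solver need not determine the meaning of $\chi$.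
   Formalization: The formal theorem adds the assumption m < n (at least one non-random god); if all gods are random (m = n, k = 0), the puzzle is solvable with no questions although m < n − m fails, so the claim as stated is false exactly there. *)

theory Defs
  imports "HOL-Library.FuncSet"
begin

datatype god_type = Truthful | Lying | Random

text \<open>The two words of the gods' language; \<open>Other\<close> is the word that is not \<open>\<chi>\<close>.\<close>

datatype word = Chi | Other

record state =
  type_of :: "nat \<Rightarrow> god_type"
  chi_means_yes :: bool

text \<open>The gods are indexed by \<open>{..<n}\<close>. The assignment of types is extensional, so a state carries
  no information beyond the types of the \<open>n\<close> gods and the meaning of \<open>\<chi>\<close>.\<close>

definition states :: "nat \<Rightarrow> nat \<Rightarrow> nat \<Rightarrow> state set" where
  "states n m k = {s. type_of s \<in> {..<n} \<rightarrow>\<^sub>E UNIV \<and>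
     card {i \<in> {..<n}. type_of s i = Random} = m \<and>
     card {i \<in> {..<n}. type_of s i = Truthful} = k \<and>
     card {i \<in> {..<n}. type_of s i = Lying} = n - m - k}"

text \<open>A question is given by its truth value in each state. Hypothetical questions about non-random
  gods are included: the word a non-random god would give to a question is a function of the state
  (see \<open>may_answer\<close>).\<close>

type_synonym question = "state \<Rightarrow> bool"

definition word_for :: "state \<Rightarrow> bool \<Rightarrow> word" where
  "word_for s b = (if b = chi_means_yes s then Chi else Other)"

definition may_answer :: "state \<Rightarrow> nat \<Rightarrow> question \<Rightarrow> word \<Rightarrow> bool" where
  "may_answer s i q w = (case type_of s i of
     Truthful \<Rightarrow> w = word_for s (q s)
   | Lying \<Rightarrow> w = word_for s (\<not> q s)
   | Random \<Rightarrow> True)"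

text \<open>An adaptive strategy: either announce the types of all gods, or ask a god a question and
  continue depending on the word received. Elements of the datatype are well-founded and branch
  finitely, hence every strategy asks a bounded number of questions.\<close>

datatype strategy =
  Announce "nat \<Rightarrow> god_type"
| Ask nat question "word \<Rightarrow> strategy"

primrec asks_only :: "nat \<Rightarrow> strategy \<Rightarrow> bool" where
  "asks_only n (Announce t) \<longleftrightarrow> True"
| "asks_only n (Ask i q next_step) \<longleftrightarrow> i < n \<and> (\<forall>w. asks_only n (next_step w))"

text \<open>\<open>outcome s \<sigma> t\<close>: in state \<open>s\<close>, for some possible answers of the random gods, the strategy
  \<open>\<sigma>\<close> ends by announcing \<open>t\<close>.\<close>

inductive outcome :: "state \<Rightarrow> strategy \<Rightarrow> (nat \<Rightarrow> god_type) \<Rightarrow> bool" for s where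
  announce: "outcome s (Announce t) t"
| ask: "may_answer s i q w \<Longrightarrow> outcome s (next_step w) t \<Longrightarrow> outcome s (Ask i q next_step) t"

definition solvable :: "nat \<Rightarrow> nat \<Rightarrow> nat \<Rightarrow> bool" where
  "solvable n m k \<longleftrightarrow> (\<exists>\<sigma>. asks_only n \<sigma> \<and>
     (\<forall>s \<in> states n m k. \<forall>t. outcome s \<sigma> t \<longrightarrow> (\<forall>i<n. t i = type_of s i)))"

text \<open>If all gods are random (in particular if there are no gods), their types are known without
  asking anything, so the puzzle is solvable although \<open>m < n - m\<close> fails.\<close>

lemma solvable_all_random: "solvable n n 0"
proof -
  have "type_of s i = Random" if "s \<in> states n n 0" "i < n" for s i
  proof -
    have "card {i \<in> {..<n}. type_of s i = Random} = card {..<n}"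
      using that(1) by (simp add: states_def)
    then have "{i \<in> {..<n}. type_of s i = Random} = {..<n}"
      by (intro card_subset_eq) auto
    then show ?thesis using that(2) by blast
  qed
  then show ?thesis
    unfolding solvable_def
    by (intro exI[of _ "Announce (\<lambda>_. Random)"]) (auto elim: outcome.cases)
qed

end

theory Submission
  imports Defs
begin

text \<open>
  Suppose first that the non-random gods form a strict majority. The solver can neutralise both
  lying and the unknown language: any proposition \<open>P\<close> about the state can be disguised as a
  question to god \<open>i\<close> to which a truthful and a lying god alike respond \<open>\<chi>\<close> exactly if \<open>P\<close>
  holds (\<open>disguise\<close>). When every god is asked the disguised \<open>P\<close>, the \<open>n - m\<close> non-random gods
  all give the correct indication and the \<open>m\<close> random ones are outvoted, so the truth value of \<open>P\<close>
  becomes known (\<open>outcome_decide\<close>). Deciding in this way, god after god, which type it has solves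
  the puzzle.

  Suppose conversely that \<open>n - m \<le> m\<close>. Then there are two states whose sets of non-random gods
  are disjoint. Each god is random in at least one of the two, so it can always give an answer
  that is possible in both: the one dictated by the state in which it is not random. Hence every
  strategy has a run that occurs in both states (\<open>common_outcome\<close>) and announces the same types in
  both, although these differ at the non-random gods, of which there is at least one because
  \<open>m < n\<close>.
\<close>

text \<open>The embedded-question trick. A truthful god speaks \<open>\<chi>\<close> exactly if the truth value of the
  question agrees with \<open>\<chi>\<close> meaning yes, so asking whether \<open>P\<close> agrees with \<open>\<chi>\<close> meaning yes
  cancels the unknown language; a further negation for a lying god cancels the lie.\<close>

definition disguise :: "nat \<Rightarrow> question \<Rightarrow> question" where
  "disguise i P = (\<lambda>s. (type_of s i = Truthful) = (P s = chi_means_yes s))"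

lemma may_answer_disguise:
  assumes "type_of s i \<noteq> Random"
  shows "may_answer s i (disguise i P) w \<longleftrightarrow> (w = Chi \<longleftrightarrow> P s)"
  using assms
  by (cases "type_of s i"; cases w) (auto simp: may_answer_def disguise_def word_for_def)

inductive_cases outcome_AnnounceE: "outcome s (Announce u) t"
inductive_cases outcome_AskE: "outcome s (Ask i q next_step) t"

text \<open>A strategy returns nothing but its final announcement, so the tally of \<open>\<chi>\<close> answers,
  accumulated in \<open>c\<close>, is handed to a continuation \<open>\<tau>\<close>.\<close>

primrec poll :: "question \<Rightarrow> nat \<Rightarrow> nat \<Rightarrow> (nat \<Rightarrow> strategy) \<Rightarrow> strategy" where
  "poll P 0 c \<tau> = \<tau> c"
| "poll P (Suc j) c \<tau> =
     Ask j (disguise j P) (\<lambda>w. poll P j (if w = Chi then Suc c else c) \<tau>)"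

lemma asks_only_poll:
  assumes "\<And>d. asks_only n (\<tau> d)" and "j \<le> n"
  shows "asks_only n (poll P j c \<tau>)"
  using assms(2) by (induction j arbitrary: c) (auto simp: assms(1))

lemma card_below_Suc:
  "card {i \<in> {..<Suc j}. Q i} = card {i \<in> {..<j}. Q i} + (if Q j then 1 else 0)"
proof -
  have "{i \<in> {..<Suc j}. Q i} = (if Q j then insert j {i \<in> {..<j}. Q i} else {i \<in> {..<j}. Q i})"
    by (auto simp: less_Suc_eq)
  then show ?thesis by simp
qed

text \<open>The random gods can distort the tally by at most their own number: upwards if \<open>P\<close> is false,
  downwards if \<open>P\<close> is true.\<close>

lemma outcome_poll:
  assumes "outcome s (poll P j c \<tau>) t"
  shows "\<exists>d. outcome s (\<tau> d) t \<and>
    (P s \<longrightarrow> c + card {i \<in> {..<j}. type_of s i \<noteq> Random} \<le> d) \<and>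
    (\<not> P s \<longrightarrow> d \<le> c + card {i \<in> {..<j}. type_of s i = Random})"
  using assms
proof (induction j arbitrary: c)
  case 0
  then show ?case by auto
next
  case (Suc j)
  from Suc.prems obtain w where w: "may_answer s j (disguise j P) w"
    and rest: "outcome s (poll P j (if w = Chi then Suc c else c) \<tau>) t"
    by (auto elim: outcome_AskE)
  from Suc.IH[OF rest] obtain d where d: "outcome s (\<tau> d) t"
    and true: "P s \<Longrightarrow>
      (if w = Chi then Suc c else c) + card {i \<in> {..<j}. type_of s i \<noteq> Random} \<le> d"
    and false: "\<not> P s \<Longrightarrow>
      d \<le> (if w = Chi then Suc c else c) + card {i \<in> {..<j}. type_of s i = Random}"
    by blast
  have reliable: "w = Chi \<longleftrightarrow> P s" if "type_of s j \<noteq> Random"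
    using w that by (simp add: may_answer_disguise)
  have "c + card {i \<in> {..<Suc j}. type_of s i \<noteq> Random} \<le> d" if "P s"
    using true[OF that] reliable that unfolding card_below_Suc by (auto split: if_splits)
  moreover have "d \<le> c + card {i \<in> {..<Suc j}. type_of s i = Random}" if "\<not> P s"
    using false[OF that] reliable that unfolding card_below_Suc by (auto split: if_splits)
  ultimately show ?case using d by blast
qed

definition decide :: "nat \<Rightarrow> nat \<Rightarrow> question \<Rightarrow> strategy \<Rightarrow> strategy \<Rightarrow> strategy" where
  "decide n m P \<sigma> \<sigma>' = poll P n 0 (\<lambda>d. if m < d then \<sigma> else \<sigma>')"

lemma asks_only_decide:
  assumes "asks_only n \<sigma>" and "asks_only n \<sigma>'"
  shows "asks_only n (decide n m P \<sigma> \<sigma>')"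
  unfolding decide_def by (rule asks_only_poll) (simp_all add: assms)

lemma card_not_random:
  assumes "s \<in> states n m k"
  shows "card {i \<in> {..<n}. type_of s i \<noteq> Random} = n - m"
proof -
  have "card ({..<n} - {i \<in> {..<n}. type_of s i = Random}) = n - m"
    using assms by (subst card_Diff_subset) (auto simp: states_def)
  moreover have "{..<n} - {i \<in> {..<n}. type_of s i = Random} =
      {i \<in> {..<n}. type_of s i \<noteq> Random}"
    by auto
  ultimately show ?thesis by simp
qed

text \<open>With fewer than half of the gods random, the tally is at least \<open>n - m > m\<close> if \<open>P\<close> holds and at
  most \<open>m\<close> otherwise, so the threshold \<open>m\<close> separates the two cases.\<close>

lemma outcome_decide:
  assumes "s \<in> states n m k" and "m < n - m" and "outcome s (decide n m P \<sigma> \<sigma>') t"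
  shows "outcome s (if P s then \<sigma> else \<sigma>') t"
proof -
  have "card {i \<in> {..<n}. type_of s i = Random} = m"
    using assms(1) by (simp add: states_def)
  with outcome_poll[OF assms(3)[unfolded decide_def]] card_not_random[OF assms(1)]
  obtain d where "outcome s (if m < d then \<sigma> else \<sigma>') t"
    and "P s \<longrightarrow> n - m \<le> d" and "\<not> P s \<longrightarrow> d \<le> m"
    by auto
  with assms(2) show ?thesis by (cases "P s") auto
qed

text \<open>The types of the gods \<open>0, \<dots>, j - 1\<close> are still to be found; \<open>a\<close> records those found already.\<close>

primrec identify :: "nat \<Rightarrow> nat \<Rightarrow> nat \<Rightarrow> (nat \<Rightarrow> god_type) \<Rightarrow> strategy" where
  "identify n m 0 a = Announce a"
| "identify n m (Suc j) a =
     decide n m (\<lambda>s. type_of s j = Truthful) (identify n m j (a(j := Truthful)))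
       (decide n m (\<lambda>s. type_of s j = Lying) (identify n m j (a(j := Lying)))
         (identify n m j (a(j := Random))))"

lemma asks_only_identify: "asks_only n (identify n m j a)"
  by (induction j arbitrary: a) (auto intro: asks_only_decide)

lemma outcome_identify:
  assumes "s \<in> states n m k" and "m < n - m" and "outcome s (identify n m j a) t"
  shows "t i = (if i < j then type_of s i else a i)"
  using assms(3)
proof (induction j arbitrary: a)
  case 0
  then show ?case by (auto elim: outcome_AnnounceE)
next
  case (Suc j)
  note decided = outcome_decide[OF assms(1,2)]
  have "outcome s (identify n m j (a(j := type_of s j))) t"
  proof (cases "type_of s j = Truthful")
    case True
    with decided[OF Suc.prems[unfolded identify.simps]] show ?thesis by simp
  next
    case False
    with decided[OF Suc.prems[unfolded identify.simps]]
    have "outcome s (decide n m (\<lambda>s. type_of s j = Lying) (identify n m j (a(j := Lying)))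
        (identify n m j (a(j := Random)))) t"
      by simp
    from decided[OF this] False show ?thesis by (cases "type_of s j") simp_all
  qed
  from Suc.IH[OF this] show ?case by (auto simp: less_Suc_eq)
qed

lemma solvable_if_random_minority:
  assumes "m < n - m"
  shows "solvable n m k"
  unfolding solvable_def
proof (intro exI conjI ballI allI impI)
  show "asks_only n (identify n m n (\<lambda>_. Random))" by (rule asks_only_identify)
next
  fix s t i
  assume "s \<in> states n m k" "outcome s (identify n m n (\<lambda>_. Random)) t" "i < n"
  then show "t i = type_of s i" using outcome_identify[OF _ assms, of s k n _ t i] by simp
qed

lemma may_answer_exists: "\<exists>w. may_answer s i q w"
  by (cases "type_of s i") (auto simp: may_answer_def)

text \<open>The god asked is random in one of the two states, where it may say anything, in particular
  the word that the other state prescribes.\<close>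

lemma common_outcome:
  assumes "\<And>i. i < n \<Longrightarrow> type_of s i = Random \<or> type_of s' i = Random"
    and "asks_only n \<sigma>"
  shows "\<exists>t. outcome s \<sigma> t \<and> outcome s' \<sigma> t"
  using assms(2)
proof (induction \<sigma>)
  case (Announce u)
  show ?case by (blast intro: outcome.announce)
next
  case (Ask i q next_step)
  from Ask.prems have "i < n" by simp
  then obtain w where w: "may_answer s i q w" "may_answer s' i q w"
    using assms(1)[of i] may_answer_exists[of s i q] may_answer_exists[of s' i q]
    by (auto simp: may_answer_def)
  from Ask.IH[of "next_step w"] Ask.prems
  obtain t where "outcome s (next_step w) t" "outcome s' (next_step w) t" by auto
  with w show ?case by (blast intro: outcome.ask)
qed

lemma state_from_partition:
  assumes "finite T" "finite L" "T \<inter> L = {}" "T \<union> L \<subseteq> {..<n}" "card T = k" "card L = n - m - k"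
    and "m + k \<le> n"
  shows "\<exists>s \<in> states n m k. \<forall>i<n. type_of s i = Random \<longleftrightarrow> i \<notin> T \<union> L"
proof -
  define s where "s = \<lparr>type_of = restrict (\<lambda>i. if i \<in> T then Truthful else if i \<in> L then Lying
    else Random) {..<n}, chi_means_yes = True\<rparr>"
  have "{i \<in> {..<n}. type_of s i = Truthful} = T" "{i \<in> {..<n}. type_of s i = Lying} = L"
    "{i \<in> {..<n}. type_of s i = Random} = {..<n} - (T \<union> L)"
    using assms(3,4) by (auto simp: s_def)
  moreover have "card ({..<n} - (T \<union> L)) = m"
    using assms by (simp add: card_Diff_subset card_Un_disjoint)
  moreover have "type_of s \<in> {..<n} \<rightarrow>\<^sub>E UNIV" by (simp add: s_def)
  ultimately have "s \<in> states n m k" using assms(5,6) by (simp add: states_def)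
  moreover have "\<forall>i<n. type_of s i = Random \<longleftrightarrow> i \<notin> T \<union> L" by (simp add: s_def)
  ultimately show ?thesis by blast
qed

text \<open>The two indistinguishable states have the first and the last \<open>n - m\<close> gods non-random;
  these two blocks are disjoint because \<open>n - m \<le> m\<close>.\<close>

lemma unsolvable_if_no_random_minority:
  assumes "m + k \<le> n" and "m < n" and "n - m \<le> m"
  shows "\<not> solvable n m k"
proof
  assume "solvable n m k"
  then obtain \<sigma> where \<sigma>: "asks_only n \<sigma>"
    and correct: "\<And>s t i. s \<in> states n m k \<Longrightarrow> outcome s \<sigma> t \<Longrightarrow> i < n \<Longrightarrow> t i = type_of s i"
    unfolding solvable_def by blast
  have "\<exists>s \<in> states n m k. \<forall>i<n. type_of s i = Random \<longleftrightarrow> i \<notin> {..<k} \<union> {k..<n - m}"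
    by (rule state_from_partition) (use assms in auto)
  moreover have "{..<k} \<union> {k..<n - m} = {..<n - m}" using assms(1) by auto
  ultimately obtain s where s: "s \<in> states n m k"
    "\<And>i. i < n \<Longrightarrow> type_of s i = Random \<longleftrightarrow> n - m \<le> i"
    by (auto simp: not_less)
  have "\<exists>s \<in> states n m k. \<forall>i<n. type_of s i = Random \<longleftrightarrow> i \<notin> {m..<m + k} \<union> {m + k..<n}"
    by (rule state_from_partition) (use assms in auto)
  moreover have "{m..<m + k} \<union> {m + k..<n} = {m..<n}" using assms(1) by auto
  ultimately obtain s' where s': "s' \<in> states n m k"
    "\<And>i. i < n \<Longrightarrow> type_of s' i = Random \<longleftrightarrow> i < m"
    by (auto simp: not_le)
  have "type_of s i = Random \<or> type_of s' i = Random" if "i < n" for i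
    using s(2)[OF that] s'(2)[OF that] assms(3) by linarith
  from common_outcome[OF this \<sigma>] obtain t where t: "outcome s \<sigma> t" "outcome s' \<sigma> t" by blast
  have "type_of s 0 = type_of s' 0"
    using correct[OF s(1) t(1), of 0] correct[OF s'(1) t(2), of 0] assms(2) by simp
  then show False using s(2)[of 0] s'(2)[of 0] assms(2,3) by auto
qed

theorem theorem4p2:
  fixes n m k :: nat
  assumes "m + k \<le> n"
    and "m < n"
  shows "solvable n m k \<longleftrightarrow> m < n - m"
  using solvable_if_random_minority unsolvable_if_no_random_minority[OF assms]
  by (meson not_less)

end
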